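(* It is not the case that $A^c\Vdash^L_S\neg\neg A^i$ holds for every ecumenical formula $A^c$ and every atomic system $S$.
   Context: Basic setting. Let $\mathsf{At}$ be a countably infinite set of atomic propositions and $\mathsf{At}_\bot=\mathsf{At}\cup\{\bot\}$. An atomic rule has the form "from premises $p_1,\dots,p_n$ ($n\ge 0$) infer $p$", with $p_j,p\in\mathsf{At}_\bot$, where the derivation of each premise may discharge a set of basic sentences. An atomic system $S$ is a set of atomic rules; $S\subseteq S'$ ($S'$ extends $S$) if $S'$ contains all rules of $S$. $\Delta\vdash_S p$ means there is a natural-deduction derivation using only rules of $S$ with conclusion $p$ and undischarged assumptions in $\Delta$ (so $p\vdash_S p$). $S$ is consistent if $\nvdash_S\bot$. Standing convention: all atomic systems (including all extensions quantified over) are required to be consistent. Ecumenical formulas: $p^i,p^c$ for $p\in\mathsf{At}_\bot$; $(A\wedge B)^x,(A\vee B)^x,(A\to B)^x$ for $x\in\{i,c\}$. $A\wedge B$, $A\vee B$, $A\to B$ abbreviate the $i$-versions, $\bot$ denotes $\bot^i$, $\neg A:=(A\to\bot^i)^i$; for $X^c$, $X^i$ is the same construction with outer superscript $i$. Weak validity (by simultaneous recursion): (1) $\Vdash^L_S p^i$ iff $\vdash_S p$ ($p\in\mathsf{At}_\bot$); (2) $\Vdash^L_S p^c$ iff $p\nvdash_S\bot$; (3) for non-atomic $X$, $\Vdash^L_S X^c$ iff $X^i\nVdash^L_S\bot$; (4) $\Vdash^L_S(A\wedge B)^i$ iff $\Vdash^L_S A$ and $\Vdash^L_S B$; (5) $\Vdash^L_S(A\to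 B)^i$ iff $A\Vdash^G_S B$; (6) $\Vdash^L_S(A\vee B)^i$ iff for all $S'\supseteq S$ and all $p\in\mathsf{At}_\bot$, if $A\Vdash^L_{S'}p^i$ and $B\Vdash^L_{S'}p^i$ then $\Vdash^L_{S'}p^i$; (7) for nonempty $\Gamma$, $\Gamma\Vdash^L_S A$ iff for all $S'\supseteq S$, if $\Vdash^L_{S'}B$ for all $B\in\Gamma$ then $\Vdash^L_{S'}A$; (8) $\Gamma\Vdash^G_S A$ iff for all $S'\supseteq S$: if $\Vdash^L_{S''}B$ for all $B\in\Gamma$ and all $S''\supseteq S'$, then $\Vdash^L_{S''}A$ for all $S''\supseteq S'$. *)

theory Defs
  imports Main "HOL-Library.Countable" "HOL-Library.Infinite_Typeclass"
begin

datatype 'a basic = Atom 'a | Falsum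

text \<open>A rule \<^term>\<open>(prems, p)\<close> infers \<^term>\<open>p\<close>; each premise is paired with the set of basic
  sentences that its derivation may discharge.\<close>

type_synonym 'a rule = "('a basic set \<times> 'a basic) list \<times> 'a basic"
type_synonym 'a system = "'a rule set"

inductive derives :: "'a system \<Rightarrow> 'a basic set \<Rightarrow> 'a basic \<Rightarrow> bool"
  for S :: "'a system" where
  assumption: "p \<in> \<Delta> \<Longrightarrow> derives S \<Delta> p"
| inference: "(prems, p) \<in> S \<Longrightarrow>
    (\<And>P q. (P, q) \<in> set prems \<Longrightarrow> derives S (\<Delta> \<union> P) q) \<Longrightarrow> derives S \<Delta> p"

definition consistent :: "'a system \<Rightarrow> bool" where
  "consistent S \<longleftrightarrow> \<not> derives S {} Falsum"

text \<open>Only consistent extensions are ever quantified over.\<close>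

definition extends :: "'a system \<Rightarrow> 'a system \<Rightarrow> bool" (infix \<open>extends\<close> 50) where
  "S' extends S \<longleftrightarrow> S \<subseteq> S' \<and> consistent S'"

datatype mode = Intu | Clas

text \<open>The ecumenical formulas $X^i$ and $X^c$ are \<^term>\<open>Fm X Intu\<close> and \<^term>\<open>Fm X Clas\<close>.\<close>

datatype 'a construct =
    Basic "'a basic"
  | Conj "'a formula" "'a formula"
  | Disj "'a formula" "'a formula"
  | Impl "'a formula" "'a formula"
and 'a formula = Fm "'a construct" mode

abbreviation falsum_i :: "'a formula" where
  "falsum_i \<equiv> Fm (Basic Falsum) Intu"

abbreviation neg :: "'a formula \<Rightarrow> 'a formula" where
  "neg A \<equiv> Fm (Impl A falsum_i) Intu"

text \<open>The two consequence relations, relative to a notion \<open>V\<close> of validity of a formula in a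
  system. They are closed below by taking weak validity for \<open>V\<close>, which is itself defined by
  recursion through them.\<close>

definition local_conseq ::
  "('a system \<Rightarrow> 'a formula \<Rightarrow> bool) \<Rightarrow> 'a formula set \<Rightarrow> 'a system \<Rightarrow> 'a formula \<Rightarrow> bool" where
  "local_conseq V \<Gamma> S A \<longleftrightarrow>
    (if \<Gamma> = {} then V S A
     else \<forall>S'. S' extends S \<longrightarrow> (\<forall>B\<in>\<Gamma>. V S' B) \<longrightarrow> V S' A)"

definition global_conseq ::
  "('a system \<Rightarrow> 'a formula \<Rightarrow> bool) \<Rightarrow> 'a formula set \<Rightarrow> 'a system \<Rightarrow> 'a formula \<Rightarrow> bool" where
  "global_conseq V \<Gamma> S A \<longleftrightarrow>
    (\<forall>S'. S' extends S \<longrightarrow>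
      (\<forall>B\<in>\<Gamma>. \<forall>S''. S'' extends S' \<longrightarrow> V S'' B) \<longrightarrow>
      (\<forall>S''. S'' extends S' \<longrightarrow> V S'' A))"

lemma local_conseq_cong [fundef_cong]:
  assumes "\<Gamma> = \<Gamma>'" "S = S'" "A = A'"
    and "\<And>T B. B \<in> insert A' \<Gamma>' \<Longrightarrow> V T B = V' T B"
  shows "local_conseq V \<Gamma> S A = local_conseq V' \<Gamma>' S' A'"
  using assms by (simp add: local_conseq_def)

lemma global_conseq_cong [fundef_cong]:
  assumes "\<Gamma> = \<Gamma>'" "S = S'" "A = A'"
    and "\<And>T B. B \<in> insert A' \<Gamma>' \<Longrightarrow> V T B = V' T B"
  shows "global_conseq V \<Gamma> S A = global_conseq V' \<Gamma>' S' A'"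
  using assms by (simp add: global_conseq_def)

function (sequential) wvalid :: "'a system \<Rightarrow> 'a formula \<Rightarrow> bool" where
  "wvalid S (Fm (Basic p) Intu) \<longleftrightarrow> derives S {} p"
| "wvalid S (Fm (Basic p) Clas) \<longleftrightarrow> \<not> derives S {p} Falsum"
| "wvalid S (Fm X Clas) \<longleftrightarrow> \<not> local_conseq wvalid {Fm X Intu} S falsum_i"
| "wvalid S (Fm (Conj A B) Intu) \<longleftrightarrow> wvalid S A \<and> wvalid S B"
| "wvalid S (Fm (Impl A B) Intu) \<longleftrightarrow> global_conseq wvalid {A} S B"
| "wvalid S (Fm (Disj A B) Intu) \<longleftrightarrow>
    (\<forall>S' p. S' extends S \<longrightarrow>
      local_conseq wvalid {A} S' (Fm (Basic p) Intu) \<longrightarrow>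
      local_conseq wvalid {B} S' (Fm (Basic p) Intu) \<longrightarrow>
      wvalid S' (Fm (Basic p) Intu))"
  by pat_completeness auto
termination
proof (relation "measures
    [\<lambda>(S, A). case A of Fm (Basic p) m \<Rightarrow> 0 | Fm X m \<Rightarrow> Suc (size A),
     \<lambda>(S, A). case A of Fm X m \<Rightarrow> if m = Clas then 1 else 0]")
qed (auto split: formula.splits construct.splits)

abbreviation local_weak :: "'a formula set \<Rightarrow> 'a system \<Rightarrow> 'a formula \<Rightarrow> bool" where
  "local_weak \<equiv> local_conseq wvalid"

end

theory Submission imports Defs begin

text \<open>Already an atom in the empty system is a counterexample. There \<open>p\<^sup>c\<close> holds, since \<open>p\<close> does
  not refute itself without rules. But adding the rule that infers falsum from \<open>p\<close> gives a
  consistent system none of whose consistent extensions derives \<open>p\<close>, so there \<open>\<not> p\<^sup>i\<close> holds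
  globally; hence \<open>\<not>\<not> p\<^sup>i\<close> fails in the empty system.\<close>

definition refuting_system :: "'a basic \<Rightarrow> 'a system" where
  "refuting_system p = {([({}, p)], Falsum)}"

lemma derives_empty_system_iff: "derives {} \<Delta> p \<longleftrightarrow> p \<in> \<Delta>"
  by (auto elim: derives.cases intro: derives.assumption)

text \<open>The only rule has a premise and discharges nothing, so a derivation without open
  assumptions has no leaf to start from.\<close>

lemma not_derives_refuting_system: "\<not> derives (refuting_system p) {} q"
proof
  assume "derives (refuting_system p) {} q"
  then show False
    by (induction "{} :: 'a basic set" q rule: derives.induct) (auto simp: refuting_system_def)
qed

lemma consistent_refuting_system: "consistent (refuting_system p)"
  by (simp add: consistent_def not_derives_refuting_system)

text \<open>Deriving \<open>p\<close> would fire the added rule, against the consistency built into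
  \<open>extends\<close>.\<close>

lemma not_derives_extends_refuting_system:
  assumes "S extends refuting_system p"
  shows "\<not> derives S {} p"
proof
  assume "derives S {} p"
  moreover have "([({}, p)], Falsum) \<in> S"
    using assms by (auto simp: extends_def refuting_system_def)
  ultimately have "derives S {} Falsum"
    by (auto intro: derives.inference)
  with assms show False
    by (simp add: extends_def consistent_def)
qed

lemma extends_trans: "S'' extends S' \<Longrightarrow> S' extends S \<Longrightarrow> S'' extends S"
  by (auto simp: extends_def)

lemma extends_refl: "consistent S \<Longrightarrow> S extends S"
  by (simp add: extends_def)

lemma wvalid_neg_extends_refuting_system:
  assumes "S extends refuting_system p"
  shows "wvalid S (neg (Fm (Basic p) Intu))"
proof -
  \<comment> \<open>The witness is \<open>S'\<close> itself, so the global consequence holds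
    vacuously.\<close>
  have "\<not> (\<forall>S''. S'' extends S' \<longrightarrow> derives S'' {} p)" if "S' extends S" for S'
    using that assms extends_trans not_derives_extends_refuting_system
    by (metis extends_def extends_refl)
  then show ?thesis
    by (simp add: global_conseq_def) blast
qed

lemma not_wvalid_neg_neg_empty_system: "\<not> wvalid {} (neg (neg (Fm (Basic p) Intu)))"
proof
  let ?R = "refuting_system p"
  assume "wvalid {} (neg (neg (Fm (Basic p) Intu)))"
  then have "global_conseq wvalid {neg (Fm (Basic p) Intu)} {} falsum_i"
    by (simp only: wvalid.simps)
  moreover have "?R extends {}"
    by (simp add: extends_def consistent_refuting_system)
  moreover have "?R extends ?R"
    by (intro extends_refl consistent_refuting_system)
  \<comment> \<open>Both system quantifiers of the global consequence are instantiated with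
    \<open>?R\<close>.\<close>
  ultimately have "wvalid ?R falsum_i"
    unfolding global_conseq_def using wvalid_neg_extends_refuting_system by blast
  then show False
    by (simp add: not_derives_refuting_system)
qed

theorem theorem6:
  "\<not> (\<forall>(X :: 'a :: {countable, infinite} construct) (S :: 'a system).
        consistent S \<longrightarrow> local_weak {Fm X Clas} S (neg (neg (Fm X Intu))))"
proof
  assume all: "\<forall>(X :: 'a construct) (S :: 'a system).
    consistent S \<longrightarrow> local_weak {Fm X Clas} S (neg (neg (Fm X Intu)))"
  fix a :: 'a
  let ?p = "Atom a"
  have cons: "consistent ({} :: 'a system)"
    by (simp add: consistent_def derives_empty_system_iff)
  with all have "local_weak {Fm (Basic ?p) Clas} {} (neg (neg (Fm (Basic ?p) Intu)))"
    by blast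
  moreover have "wvalid {} (Fm (Basic ?p) Clas)"
    by (simp add: derives_empty_system_iff)
  ultimately have "wvalid {} (neg (neg (Fm (Basic ?p) Intu)))"
    \<comment> \<open>The local consequence is used at the empty system itself.\<close>
    using extends_refl[OF cons] by (simp only: local_conseq_def) auto
  then show False
    using not_wvalid_neg_neg_empty_system by blast
qed

end
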